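(* For every fixed positive integer $k \geq 2$, $$\liminf_{\substack{|T| \to \infty \\ T\text{ topological tree}}}\big(\gamma(C_k,T) +\gamma(F^2_k,T)\big) \geq \frac{1}{\binom{1+(k-1)^{k-2}}{k}} \geq \frac{k!}{\big( 1+(k-1)^{k-2}\big)^k}.$$
   Context: A topological tree is a finite rooted tree in which every non-leaf vertex has outdegree (number of children) at least $2$; the single-vertex tree is allowed, its vertex being both root and leaf. Trees are considered up to isomorphism of rooted trees (unordered, unlabelled). $|T|$ denotes the number of leaves of $T$. A nonempty set $L$ of leaves of $T$ induces a topological tree: take the smallest subtree of $T$ connecting the leaves in $L$, rooted at the most recent common ancestor of $L$, and suppress (erase, joining the neighbours) all vertices of outdegree $1$. For topological trees $S,T$, $c(S,T)$ is the number of subsets of the leaf set of $T$ whose induced tree is isomorphic, as a rooted tree, to $S$, and $\gamma(S,T)=c(S,T)/\binom{|T|}{|S|}$ (for $|T|\ge |S|$). $C_k$ denotes the star with $k$ leaves, i.e. the topological tree whose $k$ leaves are all children of the root. $F^2_k$ denotes the binary caterpillar with $k$ leaves, i.e. the topological tree with $k$ leaves in which every non-leaf vertex has exactly two children and all non-leaf vertices lie on a single path starting at the root. The limit inferior over topological trees with $|T|\to\infty$ means $\liminf_{n\to\infty}\min_{|T|=n}(\cdot)$, the minimum being over all topological trees $T$ with $n$ leaves. *)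

theory Defs
  imports Complex_Main "HOL-Library.Multiset" "HOL-Library.Liminf_Limsup" "HOL-Library.Extended_Real"
begin

(* Finite rooted unordered trees. Only the leaves carry names, which serve to single out
   sets of leaves. The children of a vertex form a multiset, so that forgetting the names
   leaves exactly the isomorphism class of the rooted tree: two trees are isomorphic iff
   their shapes are equal. *)

datatype (leaves: 'a) tree = Leaf 'a | Node "'a tree multiset"

abbreviation shape :: "'a tree \<Rightarrow> unit tree" where
  "shape \<equiv> map_tree (\<lambda>_. ())"

primrec leaf_mset :: "'a tree \<Rightarrow> 'a multiset" where
  "leaf_mset (Leaf a) = {#a#}"
| "leaf_mset (Node ts) = \<Sum>\<^sub># (image_mset leaf_mset ts)"

definition num_leaves :: "'a tree \<Rightarrow> nat" where
  "num_leaves T = size (leaf_mset T)"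

inductive topological :: "'a tree \<Rightarrow> bool" where
  "topological (Leaf a)"
| "2 \<le> size ts \<Longrightarrow> (\<And>t. t \<in># ts \<Longrightarrow> topological t) \<Longrightarrow> topological (Node ts)"

definition distinct_leaves :: "'a tree \<Rightarrow> bool" where
  "distinct_leaves T \<longleftrightarrow> (\<forall>a. count (leaf_mset T) a \<le> 1)"

(* The smallest subtree containing the root and the leaves in L. The pairing is only needed
   to test the original child t while recursing; see spanning_subtree_Node. *)
primrec spanning_subtree :: "'a set \<Rightarrow> 'a tree \<Rightarrow> 'a tree" where
  "spanning_subtree L (Leaf a) = Leaf a"
| "spanning_subtree L (Node ts) =
     Node (image_mset snd (filter_mset (\<lambda>(t, s). leaves t \<inter> L \<noteq> {})
       (image_mset (\<lambda>t. (t, spanning_subtree L t)) ts)))"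

(* Erases all vertices of outdegree 1. An erased root is replaced by its only child. *)
primrec suppress :: "'a tree \<Rightarrow> 'a tree" where
  "suppress (Leaf a) = Leaf a"
| "suppress (Node ts) =
     (let us = image_mset suppress ts
      in if size us = 1 then (THE u. us = {#u#}) else Node us)"

(* Compared with the smallest subtree connecting L, rooted at the most recent common
   ancestor of L, spanning_subtree L T only has in addition the vertices above that
   ancestor. They all have outdegree 1 there, so suppress erases them. *)
definition induced :: "'a set \<Rightarrow> 'a tree \<Rightarrow> 'a tree" where
  "induced L T = suppress (spanning_subtree L T)"

definition copies :: "'b tree \<Rightarrow> 'a tree \<Rightarrow> nat" where
  "copies S T = card {L. L \<subseteq> leaves T \<and> L \<noteq> {} \<and> shape (induced L T) = shape S}"

definition density :: "'b tree \<Rightarrow> 'a tree \<Rightarrow> real" where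
  "density S T = real (copies S T) / real (num_leaves T choose num_leaves S)"

definition star :: "nat \<Rightarrow> unit tree" where
  "star k = (if k = 1 then Leaf () else Node (replicate_mset k (Leaf ())))"

(* The value at 0 is a dummy. *)
fun caterpillar :: "nat \<Rightarrow> unit tree" where
  "caterpillar 0 = Leaf ()"
| "caterpillar (Suc 0) = Leaf ()"
| "caterpillar (Suc (Suc n)) = Node {#Leaf (), caterpillar (Suc n)#}"

(* The topological trees with n leaves. By shape_surj every isomorphism class occurs. *)
definition topological_trees :: "nat \<Rightarrow> nat tree set" where
  "topological_trees n = {T. topological T \<and> distinct_leaves T \<and> num_leaves T = n}"

lemma spanning_subtree_Node:
  "spanning_subtree L (Node ts) =
     Node {# spanning_subtree L t. t \<in># {# t \<in># ts. leaves t \<inter> L \<noteq> {} #} #}"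
  by (simp add: filter_mset_image_mset multiset.map_comp comp_def)

declare spanning_subtree.simps(2) [simp del] spanning_subtree_Node [simp]

lemma suppress_Node:
  "suppress (Node {#t#}) = suppress t"
  "size ts \<noteq> 1 \<Longrightarrow> suppress (Node ts) = Node (image_mset suppress ts)"
  by simp_all

lemma set_leaf_mset: "set_mset (leaf_mset T) = leaves T"
  by (induction T) auto

lemma num_leaves_Node: "num_leaves (Node ts) = sum_mset (image_mset num_leaves ts)"
  by (induction ts) (simp_all add: num_leaves_def)

lemma leaf_mset_map: "leaf_mset (map_tree f T) = image_mset f (leaf_mset T)"
proof (induction T)
  case (Node ts)
  then show ?case by (induction ts) auto
qed simp

lemma num_leaves_map: "num_leaves (map_tree f T) = num_leaves T"
  by (simp add: num_leaves_def leaf_mset_map)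

lemma topological_map: "topological T \<Longrightarrow> topological (map_tree f T)"
  by (induction rule: topological.induct) (auto intro!: topological.intros)

lemma num_leaves_star: "0 < k \<Longrightarrow> num_leaves (star k) = k"
  by (auto simp: star_def num_leaves_def)

lemma num_leaves_caterpillar: "0 < k \<Longrightarrow> num_leaves (caterpillar k) = k"
  by (induction k rule: caterpillar.induct) (auto simp: num_leaves_def)

lemma topological_star: "0 < k \<Longrightarrow> topological (star k)"
  by (auto simp: star_def intro!: topological.intros split: if_splits)

lemma topological_caterpillar: "topological (caterpillar k)"
  by (induction k rule: caterpillar.induct) (auto intro!: topological.intros)

lemma leaf_mset_suppress: "leaf_mset (suppress T) = leaf_mset T"
proof (induction T)
  case (Node ts)
  then have "image_mset leaf_mset (image_mset suppress ts) = image_mset leaf_mset ts"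
    by (simp add: multiset.map_comp comp_def cong: image_mset_cong)
  moreover have "leaf_mset (suppress (Node ts)) =
      \<Sum>\<^sub># (image_mset leaf_mset (image_mset suppress ts))"
  proof (cases "size ts = 1")
    case True
    then obtain t where "ts = {#t#}" using size_1_singleton_mset by blast
    then show ?thesis by simp
  qed (simp add: suppress_Node(2) del: suppress.simps)
  ultimately show ?case by simp
qed simp

lemma leaf_mset_spanning_subtree:
  "leaves T \<inter> L \<noteq> {} \<Longrightarrow> leaf_mset (spanning_subtree L T) = {# a \<in># leaf_mset T. a \<in> L #}"
proof (induction T)
  case (Node ts)
  have "\<Sum>\<^sub># (image_mset leaf_mset (image_mset (spanning_subtree L)
          {# t \<in># ts. leaves t \<inter> L \<noteq> {} #})) = {# a \<in># \<Sum>\<^sub># (image_mset leaf_mset ts). a \<in> L #}"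
    using Node.IH
  proof (induction ts)
    case (add t ts)
    have "{# a \<in># leaf_mset t. a \<in> L #} = {#}" if "leaves t \<inter> L = {}"
      using that set_leaf_mset[of t] by (auto simp: filter_mset_eq_conv)
    then show ?case using add by auto
  qed simp
  then show ?case by simp
qed auto

lemma leaf_mset_induced:
  "leaves T \<inter> L \<noteq> {} \<Longrightarrow> leaf_mset (induced L T) = {# a \<in># leaf_mset T. a \<in> L #}"
  by (simp add: induced_def leaf_mset_suppress leaf_mset_spanning_subtree)

lemma topological_induced:
  "leaves T \<inter> L \<noteq> {} \<Longrightarrow> topological (induced L T)"
  unfolding induced_def
proof (induction T)
  case (Node ts)
  define us where "us = image_mset (spanning_subtree L) {# t \<in># ts. leaves t \<inter> L \<noteq> {} #}"
  have us: "topological (suppress u)" if "u \<in># us" for u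
    using that Node.IH by (auto simp: us_def)
  have "us \<noteq> {#}"
    using Node.prems by (auto simp: us_def filter_mset_eq_conv)
  then consider "size us = 1" | "size us \<ge> 2"
    by (cases us) (auto simp: Suc_le_eq)
  then have "topological (suppress (Node us))"
  proof cases
    case 1
    then obtain u where "us = {#u#}" using size_1_singleton_mset by blast
    then show ?thesis using us by simp
  next
    case 2
    then show ?thesis using us by (auto simp: suppress_Node(2) intro!: topological.intros(2))
  qed
  then show ?case by (simp add: us_def)
qed (auto intro: topological.intros)

lemma topological_shape: "topological (shape T) \<Longrightarrow> topological T"
proof (induction T)
  case (Node ts)
  from Node.prems show ?case
    by cases (auto intro!: topological.intros(2) intro: Node.IH)
qed (auto intro: topological.intros)

lemma finite_leaves: "finite (leaves T)"
  by (metis finite_set_mset set_leaf_mset)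

lemma shape_surj_aux:
  "\<exists>T :: nat tree. shape T = S \<and> distinct_leaves T \<and> leaves T \<inter> {..<m} = {}"
proof (induction S arbitrary: m)
  case (Leaf a)
  show ?case by (rule exI[of _ "Leaf m"]) (auto simp: distinct_leaves_def)
next
  case (Node ss)
  have "\<exists>ts :: nat tree multiset. image_mset shape ts = ss \<and> distinct_leaves (Node ts) \<and>
          leaves (Node ts) \<inter> {..<m} = {}"
    using Node
  proof (induction ss arbitrary: m)
    case empty
    show ?case by (rule exI[of _ "{#}"]) (simp add: distinct_leaves_def)
  next
    case (add s ss)
    have "\<exists>ts :: nat tree multiset. image_mset shape ts = ss \<and> distinct_leaves (Node ts) \<and>
            leaves (Node ts) \<inter> {..<m} = {}"
      by (rule add.IH, rule add.prems) simp
    then obtain ts :: "nat tree multiset" where ts: "image_mset shape ts = ss"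
      "distinct_leaves (Node ts)" "leaves (Node ts) \<inter> {..<m} = {}"
      by (elim exE conjE)
    obtain M where M: "leaves (Node ts) \<subseteq> {..<M}"
      using finite_leaves[of "Node ts"] finite_nat_iff_bounded by blast
    obtain t :: "nat tree" where t: "shape t = s" "distinct_leaves t"
      "leaves t \<inter> {..<max m M} = {}"
      using add.prems[of s "max m M"] by (elim exE conjE meta_impE) simp_all
    have t': "a \<notin> {..<m}" "a \<notin> {..<M}" if "a \<in> leaves t" for a
      using t(3) that by (auto simp: disjoint_iff)
    have disj: "count (leaf_mset t) a = 0 \<or> count (leaf_mset (Node ts)) a = 0" for a
      unfolding count_eq_zero_iff set_leaf_mset using M t'(2) by blast
    have "count (leaf_mset (Node (add_mset t ts))) a \<le> 1" for a
    proof -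
      have "count (leaf_mset t) a \<le> 1" "count (leaf_mset (Node ts)) a \<le> 1"
        using ts(2) t(2) unfolding distinct_leaves_def by blast+
      moreover have "leaf_mset (Node (add_mset t ts)) = leaf_mset t + leaf_mset (Node ts)"
        by simp
      ultimately show ?thesis using disj[of a] by (metis add_0 add.right_neutral count_union)
    qed
    then have "distinct_leaves (Node (add_mset t ts))"
      unfolding distinct_leaves_def by blast
    moreover have "leaves (Node (add_mset t ts)) = leaves t \<union> leaves (Node ts)"
      by simp
    then have "leaves (Node (add_mset t ts)) \<inter> {..<m} = {}"
      using ts(3) t'(1) by blast
    moreover have "image_mset shape (add_mset t ts) = add_mset s ss"
      using ts(1) t(1) by simp
    ultimately show ?case by blast
  qed
  then obtain ts :: "nat tree multiset" where "image_mset shape ts = ss"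
    "distinct_leaves (Node ts)" "leaves (Node ts) \<inter> {..<m} = {}"
    by (elim exE conjE)
  then show ?case by (intro exI[of _ "Node ts"]) simp
qed

lemma shape_surj:
  assumes "topological S"
  shows "\<exists>T \<in> topological_trees (num_leaves S). shape T = shape S"
proof -
  obtain T :: "nat tree" where T: "shape T = shape S" "distinct_leaves T"
    using shape_surj_aux[of "shape S" 0] by (elim exE conjE)
  have "topological T"
    by (rule topological_shape) (simp add: T(1) topological_map assms)
  moreover have "num_leaves T = num_leaves S"
    using T(1) num_leaves_map[of "\<lambda>_. ()" T] num_leaves_map[of "\<lambda>_. ()" S] by simp
  ultimately have "T \<in> topological_trees (num_leaves S)"
    using T(2) by (simp add: topological_trees_def)
  with T show ?thesis by blast
qed

lemma topological_trees_nonempty: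
  assumes "0 < n" shows "topological_trees n \<noteq> {}"
  using shape_surj[OF topological_star[OF assms]] num_leaves_star[OF assms] by auto

lemma card_leaves: "distinct_leaves T \<Longrightarrow> card (leaves T) = num_leaves T"
proof -
  assume "distinct_leaves T"
  then have "count (leaf_mset T) a = 1" if "a \<in># leaf_mset T" for a
    using that unfolding distinct_leaves_def by (metis One_nat_def Suc_leI antisym count_greater_zero_iff)
  then show ?thesis
    by (simp add: num_leaves_def size_multiset_overloaded_eq flip: set_leaf_mset)
qed

lemma copies_le: "T \<in> topological_trees n \<Longrightarrow> copies S T \<le> 2 ^ n"
proof -
  assume "T \<in> topological_trees n"
  then have "card (leaves T) = n" by (auto simp: topological_trees_def card_leaves)
  then have "card (Pow (leaves T)) = 2 ^ n" by (simp add: card_Pow finite_leaves)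
  moreover have "copies S T \<le> card (Pow (leaves T))"
    unfolding copies_def by (intro card_mono) (auto simp: finite_leaves)
  ultimately show ?thesis by simp
qed

lemma finite_density_values:
  "finite ((\<lambda>T. density S T + density S' T) ` topological_trees n)"
proof (rule finite_subset)
  let ?f = "\<lambda>(i, j). real i / real (n choose num_leaves S) + real j / real (n choose num_leaves S')"
  show "(\<lambda>T. density S T + density S' T) ` topological_trees n \<subseteq> ?f ` ({..2^n} \<times> {..2^n})"
  proof
    fix x assume "x \<in> (\<lambda>T. density S T + density S' T) ` topological_trees n"
    then obtain T where T: "T \<in> topological_trees n" "x = density S T + density S' T" by blast
    then have "num_leaves T = n" by (simp add: topological_trees_def)
    then have "x = ?f (copies S T, copies S' T)" using T by (simp add: density_def)
    then show "x \<in> ?f ` ({..2^n} \<times> {..2^n})"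
      by (rule image_eqI) (simp add: copies_le[OF T(1)])
  qed
qed simp

end

theory Submission
  imports Defs "HOL-Library.FuncSet"
begin

text \<open>
  Put \<open>N = 1 + (k - 1) ^ (k - 2)\<close>. A topological tree in which every vertex has at most \<open>k - 1\<close>
  children and whose height is at most \<open>k - 2\<close> has at most \<open>(k - 1) ^ (k - 2)\<close> leaves. Hence the
  tree induced by any \<open>N\<close> leaves of \<open>T\<close> has either a vertex with \<open>k\<close> children, which yields a
  copy of \<open>C\<^sub>k\<close>, or a path of length \<open>k - 1\<close> from the root, which yields a copy of the caterpillar.
  As every \<open>N\<close>-set of leaves contains such a \<open>k\<close>-set, averaging over all \<open>N\<close>-sets shows
  that a proportion of at least \<open>1 / (N choose k)\<close> of all \<open>k\<close>-sets induces one of the two.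
\<close>

section \<open>Double counting over \<open>N\<close>-subsets\<close>

text \<open>Count the pairs of some \<open>M\<close> in \<open>G\<close> and an \<open>N\<close>-set
  \<open>L\<close> containing \<open>M\<close>: each \<open>L\<close> occurs at least once, each
  \<open>M\<close> exactly \<open>(card X - k) choose (N - k)\<close> times.\<close>

lemma binomial_le_card_covering:
  assumes X: "finite X" and k: "k \<le> N" "N \<le> card X"
    and G: "\<And>M. M \<in> G \<Longrightarrow> M \<subseteq> X \<and> card M = k"
    and cover: "\<And>L. L \<subseteq> X \<Longrightarrow> card L = N \<Longrightarrow> \<exists>M\<in>G. M \<subseteq> L"
  shows "card X choose k \<le> card G * (N choose k)"
proof -
  let ?n = "card X"
  let ?U = "\<lambda>M. {L. M \<subseteq> L \<and> L \<subseteq> X \<and> card L = N}"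
  have "finite G"
    using G X by (intro finite_subset[of G "Pow X"]) auto
  have card_U: "card (?U M) = (?n - k) choose (N - k)" if "M \<in> G" for M
  proof -
    have M: "M \<subseteq> X" "card M = k" "finite M"
      using G[OF that] X by (auto intro: finite_subset)
    \<comment> \<open>An \<open>N\<close>-set above \<open>M\<close> is determined by its
      \<open>N - k\<close> elements outside \<open>M\<close>.\<close>
    have "bij_betw (\<lambda>L. L \<union> M) {L. L \<subseteq> X - M \<and> card L = N - k} (?U M)"
    proof (rule bij_betwI[where g = "\<lambda>L. L - M"])
      show "(\<lambda>L. L \<union> M) \<in> {L. L \<subseteq> X - M \<and> card L = N - k} \<rightarrow> ?U M"
      proof
        fix L assume L: "L \<in> {L. L \<subseteq> X - M \<and> card L = N - k}"
        then have "finite L" "L \<inter> M = {}" using X by (auto intro: finite_subset)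
        then have "card (L \<union> M) = N"
          using L M k by (simp add: card_Un_disjoint)
        then show "L \<union> M \<in> ?U M" using L M by auto
      qed
      show "(\<lambda>L. L - M) \<in> ?U M \<rightarrow> {L. L \<subseteq> X - M \<and> card L = N - k}"
        using M by (auto simp: card_Diff_subset)
    qed auto
    then have "card (?U M) = card {L. L \<subseteq> X - M \<and> card L = N - k}"
      by (simp add: bij_betw_same_card)
    also have "\<dots> = card (X - M) choose (N - k)"
      using X by (simp add: n_subsets)
    finally show ?thesis
      using M by (simp add: card_Diff_subset)
  qed
  have "?n choose N = card {L. L \<subseteq> X \<and> card L = N}"
    using X by (simp add: n_subsets)
  also have "\<dots> \<le> card (\<Union>M\<in>G. ?U M)"
    using cover X \<open>finite G\<close>
    by (intro card_mono finite_subset[of "\<Union>M\<in>G. ?U M" "Pow X"]) auto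
  also have "\<dots> \<le> (\<Sum>M\<in>G. card (?U M))"
    by (rule card_UN_le[OF \<open>finite G\<close>])
  also have "\<dots> = card G * ((?n - k) choose (N - k))"
    using card_U by simp
  finally have "(?n choose N) * (N choose k) \<le> card G * ((?n - k) choose (N - k)) * (N choose k)"
    by (rule mult_le_mono1)
  \<comment> \<open>\<open>choose_mult\<close> trades \<open>?n choose N\<close> for
    \<open>?n choose k\<close>; both sides then share a positive factor that cancels.\<close>
  then have "(?n choose k) * ((?n - k) choose (N - k))
      \<le> (card G * (N choose k)) * ((?n - k) choose (N - k))"
    unfolding choose_mult[OF k] by (simp only: mult_ac)
  moreover have "0 < (?n - k) choose (N - k)"
    using k by simp
  ultimately show ?thesis
    by (metis mult_le_cancel2)
qed

section \<open>Topological trees with distinct leaves\<close>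

lemma leaves_nonempty: "topological T \<Longrightarrow> leaves T \<noteq> {}"
proof (induction rule: topological.induct)
  case (2 ts)
  then obtain t where "t \<in># ts" by (metis multiset_nonemptyE not_numeral_le_zero size_empty)
  then show ?case using 2 by fastforce
qed simp

lemma topological_Node_iff:
  "topological (Node ts) \<longleftrightarrow> 2 \<le> size ts \<and> (\<forall>t\<in>#ts. topological t)"
  by (auto elim: topological.cases intro: topological.intros)

text \<open>Every child contributes at least one leaf, so an inner root, having two or more
  children, would force at least two leaves.\<close>

lemma topological_singleton:
  assumes "topological T" "leaf_mset T = {#x#}"
  shows "T = Leaf x"
proof (cases T)
  case (Leaf a)
  then show ?thesis using assms by simp
next
  case (Node ts)
  with assms(1) have ts: "2 \<le> size ts" "\<forall>t\<in>#ts. topological t"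
    by (auto simp: topological_Node_iff)
  have "size ts = (\<Sum>t\<in>#ts. 1)"
    by (rule size_eq_sum_mset)
  also have "\<dots> \<le> (\<Sum>t\<in>#ts. num_leaves t)"
  proof (rule sum_mset_mono)
    fix t assume "t \<in># ts"
    then have "leaf_mset t \<noteq> {#}"
      using ts leaves_nonempty[of t] by (auto simp flip: set_leaf_mset)
    then show "1 \<le> num_leaves t"
      by (simp add: num_leaves_def Suc_le_eq nonempty_has_size)
  qed
  also have "\<dots> = num_leaves T"
    by (simp add: Node num_leaves_Node)
  also have "\<dots> = 1"
    using assms(2) by (simp add: num_leaves_def)
  finally show ?thesis using ts by simp
qed

lemma distinct_leaves_add_mset:
  assumes "distinct_leaves (Node (add_mset t ts))"
  shows "distinct_leaves t" "distinct_leaves (Node ts)" "s \<in># ts \<Longrightarrow> leaves s \<inter> leaves t = {}"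
proof -
  have c: "count (leaf_mset t) a + count (leaf_mset (Node ts)) a \<le> 1" for a
    using assms by (simp add: distinct_leaves_def)
  then show "distinct_leaves t" "distinct_leaves (Node ts)"
    unfolding distinct_leaves_def by (meson add_leD1 add_leD2)+
  have "count (leaf_mset t) a = 0 \<or> count (leaf_mset (Node ts)) a = 0" for a
    using c[of a] by linarith
  then have "leaves t \<inter> leaves (Node ts) = {}"
    by (auto simp only: count_eq_zero_iff set_leaf_mset)
  then show "s \<in># ts \<Longrightarrow> leaves s \<inter> leaves t = {}" by auto
qed

lemma distinct_leaves_child:
  "distinct_leaves (Node ts) \<Longrightarrow> t \<in># ts \<Longrightarrow> distinct_leaves t"
  using distinct_leaves_add_mset(1) by (metis mset_add)

text \<open>A repeated child would be disjoint from itself and so have no leaves. This allows the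
  children to be treated as a set.\<close>

lemma topological_children_unique:
  assumes "topological (Node ts)" "distinct_leaves (Node ts)"
  shows "mset_set (set_mset ts) = ts"
proof (rule multiset_eqI)
  fix t
  show "count (mset_set (set_mset ts)) t = count ts t"
  proof (cases "t \<in># ts")
    case True
    then obtain us where us: "ts = add_mset t us" by (meson multi_member_split)
    have "t \<notin># us"
      using distinct_leaves_add_mset(3)[of t us t] assms leaves_nonempty[of t]
      by (auto simp: us topological_Node_iff)
    then have "count ts t = 1" by (simp add: us not_in_iff)
    then show ?thesis using True by simp
  qed (simp add: not_in_iff)
qed

section \<open>Computing induced trees\<close>

lemma spanning_subtree_cong:
  "L \<inter> leaves T = L' \<inter> leaves T \<Longrightarrow> spanning_subtree L T = spanning_subtree L' T"
proof (induction T)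
  case (Node ts)
  have eq: "L \<inter> leaves t = L' \<inter> leaves t" if "t \<in># ts" for t
    using Node.prems that by auto
  then have "{#t \<in># ts. leaves t \<inter> L \<noteq> {}#} = {#t \<in># ts. leaves t \<inter> L' \<noteq> {}#}"
    by (intro filter_mset_cong) (auto simp: Int_commute)
  then show ?case
    using Node.IH eq by (auto intro!: image_mset_cong)
qed simp

lemma induced_cong:
  "L \<inter> leaves T = L' \<inter> leaves T \<Longrightarrow> induced L T = induced L' T"
  unfolding induced_def by (metis spanning_subtree_cong)

lemma induced_Node:
  "{#t \<in># ts. leaves t \<inter> L \<noteq> {}#} = {#t#} \<Longrightarrow> induced L (Node ts) = induced L t"
  "size {#t \<in># ts. leaves t \<inter> L \<noteq> {}#} \<noteq> 1 \<Longrightarrow>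
    induced L (Node ts) = Node {#induced L t. t \<in># {#t \<in># ts. leaves t \<inter> L \<noteq> {}#}#}"
  by (simp_all add: induced_def suppress_Node multiset.map_comp comp_def del: suppress.simps(2))

text \<open>Distinctness gives the induced tree the leaf multiset \<open>{#x#}\<close>; being
  topological, it must then be a single leaf.\<close>

lemma induced_singleton:
  assumes "topological T" "distinct_leaves T" "leaves T \<inter> L = {x}"
  shows "induced L T = Leaf x"
proof (rule topological_singleton)
  have L: "leaves T \<inter> L \<noteq> {}" using assms by simp
  then show "topological (induced L T)" by (rule topological_induced)
  have "count (leaf_mset T) a = (if a \<in> leaves T then 1 else 0)" for a
    using assms(2) unfolding distinct_leaves_def
    by (metis One_nat_def count_eq_zero_iff le_antisym Suc_le_eq neq0_conv set_leaf_mset)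
  moreover have x: "a \<in> leaves T \<and> a \<in> L \<longleftrightarrow> a = x" for a
    using assms(3) by blast
  ultimately have "count {#a \<in># leaf_mset T. a \<in> L#} a = count {#x#} a" for a
    using x[of a] by (cases "a = x") auto
  then have "{#a \<in># leaf_mset T. a \<in> L#} = {#x#}"
    by (rule multiset_eqI)
  then show "leaf_mset (induced L T) = {#x#}"
    using leaf_mset_induced[OF L] by simp
qed

text \<open>Ensures that a set inducing a tree with \<open>k\<close> leaves is a
  \<open>k\<close>-set, as the double counting requires.\<close>

lemma num_leaves_induced:
  assumes "distinct_leaves T" "L \<subseteq> leaves T" "L \<noteq> {}"
  shows "num_leaves (induced L T) = card L"
proof -
  have L: "leaf_mset (induced L T) = {#a \<in># leaf_mset T. a \<in> L#}"
    using assms by (intro leaf_mset_induced) auto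
  then have "distinct_leaves (induced L T)"
    using assms(1) by (auto simp: distinct_leaves_def)
  moreover have "leaves (induced L T) = L"
    using L assms(2) by (auto simp: set_leaf_mset simp flip: set_leaf_mset[of "induced L T"])
  ultimately show ?thesis using card_leaves by metis
qed

text \<open>The other children miss \<open>L\<close>, so the root keeps one child and is suppressed.
  Copies found inside a child are thus copies in the whole tree.\<close>

lemma induced_child:
  assumes "distinct_leaves (Node (add_mset t ts))" "L \<subseteq> leaves t" "L \<noteq> {}"
  shows "induced L (Node (add_mset t ts)) = induced L t"
proof (rule induced_Node(1))
  have "leaves s \<inter> L = {}" if "s \<in># ts" for s
    using distinct_leaves_add_mset(3)[OF assms(1) that] assms(2) by blast
  then show "{#s \<in># add_mset t ts. leaves s \<inter> L \<noteq> {}#} = {#t#}"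
    using assms(2,3) by (auto simp: filter_mset_eq_conv)
qed

section \<open>Finding stars and caterpillars\<close>

text \<open>Exactly the children \<open>t\<close> and \<open>s\<close> meet
  \<open>insert x M\<close>. The root therefore survives with two children, the old caterpillar and
  the new leaf \<open>x\<close>.\<close>

lemma caterpillar_extend:
  assumes T: "topological (Node ts)" "distinct_leaves (Node ts)"
    and t: "t \<in># ts" "M \<subseteq> leaves t" "M \<noteq> {}" "shape (induced M t) = caterpillar (Suc n)"
    and s: "s \<in># ts" "s \<noteq> t" "x \<in> leaves s"
  shows "shape (induced (insert x M) (Node ts)) = caterpillar (Suc (Suc n))"
proof -
  obtain us where us: "ts = add_mset t us" "s \<in># us"
    using t(1) s(1,2) by (metis insert_noteq_member mset_add)
  then obtain vs where vs: "us = add_mset s vs" by (meson multi_member_split)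
  have ts: "ts = add_mset t (add_mset s vs)" by (simp add: us vs)
  have D: "distinct_leaves (Node (add_mset t (add_mset s vs)))" using T(2) ts by simp
  note disj = distinct_leaves_add_mset(3)[OF D]
    distinct_leaves_add_mset(3)[OF distinct_leaves_add_mset(2)[OF D]]
  have st: "leaves s \<inter> leaves t = {}" using disj(1)[of s] by simp
  have "leaves v \<inter> insert x M = {}" if "v \<in># vs" for v
    using disj(1)[of v] disj(2)[of v] that t(2) s(3) by auto
  then have "{#v \<in># ts. leaves v \<inter> insert x M \<noteq> {}#} = {#t, s#}"
    using t(2,3) s(3) by (auto simp: ts filter_mset_eq_conv)
  moreover have "induced (insert x M) t = induced M t"
    using st s(3) by (intro induced_cong) auto
  moreover have "induced (insert x M) s = Leaf x"
    using T(1) D distinct_leaves_add_mset[of t us] distinct_leaves_add_mset(1)[of s vs] st s(3) t(2)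
    by (intro induced_singleton) (auto simp: us vs topological_Node_iff)
  ultimately show ?thesis
    using t(4) induced_Node(2)[of "insert x M" ts] by (simp add: add_mset_commute)
qed

text \<open>Choose one leaf of \<open>L\<close> below each child in \<open>S\<close>: these children
  shrink to single leaves and all others disappear.\<close>

lemma star_of_children:
  assumes T: "topological (Node ts)" "distinct_leaves (Node ts)"
    and S: "S \<subseteq> set_mset ts" "2 \<le> card S" "\<And>t. t \<in> S \<Longrightarrow> leaves t \<inter> L \<noteq> {}"
  obtains M where "M \<subseteq> L" "M \<noteq> {}" "shape (induced M (Node ts)) = star (card S)"
proof -
  obtain f where f: "\<And>t. t \<in> S \<Longrightarrow> f t \<in> leaves t \<inter> L"
    using bchoice[of S "\<lambda>t x. x \<in> leaves t \<inter> L"] S(3) by blast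
  let ?M = "f ` S"
  have disj: "leaves s \<inter> leaves t = {}" if "s \<in># ts" "t \<in># ts" "s \<noteq> t" for s t
    using that T(2) distinct_leaves_add_mset(3) by (metis insert_noteq_member mset_add)
  have meet: "leaves t \<inter> ?M = {f t}" if "t \<in> S" for t
    using f that disj S(1) by blast
  have nomeet: "leaves t \<inter> ?M = {}" if "t \<in># ts" "t \<notin> S" for t
    using f that disj S(1) by blast
  \<comment> \<open>Rewriting \<open>ts\<close> as a set of children makes the number of surviving
    children exactly \<open>card S\<close>.\<close>
  have "{#t \<in># ts. leaves t \<inter> ?M \<noteq> {}#} = {#t \<in># mset_set (set_mset ts). t \<in> S#}"
    unfolding topological_children_unique[OF T]
    by (rule filter_mset_cong[OF refl]) (use meet nomeet in blast)
  also have "\<dots> = mset_set S"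
    using S(1) by (auto simp: filter_mset_mset_set intro!: arg_cong[of _ _ mset_set])
  finally have flt: "{#t \<in># ts. leaves t \<inter> ?M \<noteq> {}#} = mset_set S" .
  have leaf: "shape (induced ?M t) = Leaf ()" if "t \<in> S" for t
  proof -
    have "t \<in># ts" using that S(1) by blast
    then have "topological t" "distinct_leaves t"
      using T distinct_leaves_child by (auto simp: topological_Node_iff)
    from induced_singleton[OF this meet[OF that]] show ?thesis by simp
  qed
  have "finite S" using S(1) finite_subset by blast
  have "shape (induced ?M (Node ts)) = Node {#shape (induced ?M t). t \<in># mset_set S#}"
    using induced_Node(2)[of ?M ts] S(2) by (simp add: flt multiset.map_comp comp_def)
  also have "{#shape (induced ?M t). t \<in># mset_set S#} = {#Leaf (). t \<in># mset_set S#}"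
    using leaf \<open>finite S\<close> by (intro image_mset_cong) auto
  finally have "shape (induced ?M (Node ts)) = star (card S)"
    using S(2) by (simp add: star_def image_mset_const_eq)
  moreover have "?M \<subseteq> L" "?M \<noteq> {}" using f S(2) by auto
  ultimately show ?thesis using that by blast
qed

text \<open>Induction on \<open>T\<close> with \<open>L\<close> and \<open>h\<close> free, split by
  the number of children meeting \<open>L\<close>. If there is one, descend with the same
  \<open>h\<close>. If there are more than \<open>d\<close>, pick a star. Otherwise, for positive
  \<open>h\<close>, some child has more than \<open>d ^ (h - 1)\<close> leaves of \<open>L\<close>,
  and a caterpillar found there is extended by a leaf of \<open>L\<close> below another
  child.\<close>

lemma star_or_caterpillar:
  assumes "1 \<le> d" "topological T" "distinct_leaves T" "L \<subseteq> leaves T" "d ^ h < card L"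
  shows "\<exists>M. M \<subseteq> L \<and> M \<noteq> {} \<and>
    (shape (induced M T) = star (Suc d) \<or> shape (induced M T) = caterpillar (Suc (Suc h)))"
  using assms(2-)
proof (induction T arbitrary: L h rule: tree.induct)
  case (Leaf a)
  then have "card L \<le> card {a}" by (intro card_mono) auto
  moreover have "1 \<le> d ^ h" using assms(1) by simp
  ultimately show ?case using Leaf by simp
next
  case (Node ts)
  note T = Node.prems(1,2)
  define U where "U = {t \<in> set_mset ts. leaves t \<inter> L \<noteq> {}}"
  have U: "finite U" "U \<subseteq> set_mset ts" by (simp_all add: U_def)
  have LU: "L = (\<Union>t\<in>U. leaves t \<inter> L)" using Node.prems(3) unfolding U_def tree.set by blast
  have child: "topological t" "distinct_leaves t" if "t \<in># ts" for t
    using that T distinct_leaves_child by (auto simp: topological_Node_iff)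
  have lift: "induced M (Node ts) = induced M t" if "t \<in># ts" "M \<subseteq> leaves t" "M \<noteq> {}" for M t
    using that T(2) induced_child by (metis mset_add)
  have "L \<noteq> {}" using Node.prems(4) by auto
  then obtain t0 where t0: "t0 \<in> U" using LU by blast
  have "U = {t0} \<or> (\<exists>s\<in>U. s \<noteq> t0)" using t0 by blast
  then consider (sub) "U = {t0}" | (many) "Suc d \<le> card U" | (few) s where "s \<in> U" "s \<noteq> t0" "card U \<le> d"
    using not_less_eq_eq by blast
  then show ?case
  proof cases
    case sub
    then have L: "t0 \<in># ts" "L \<subseteq> leaves t0" using LU U(2) by auto
    from Node.IH[OF L(1) child[OF L(1)] L(2) Node.prems(4)] show ?thesis
      using lift[OF L(1)] L(2) by (metis order_trans)
  next
    case many
    then obtain S where S: "S \<subseteq> U" "card S = Suc d" by (meson obtain_subset_with_card_n)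
    obtain M where "M \<subseteq> L" "M \<noteq> {}" "shape (induced M (Node ts)) = star (card S)"
      by (rule star_of_children[OF T, of S L]) (use S assms(1) in \<open>auto simp: U_def\<close>)
    then show ?thesis using S(2) by metis
  next
    case few
    \<comment> \<open>Since \<open>U\<close> has at least two members, whichever child carries the
      caterpillar, another one supplies the extra leaf.\<close>
    have ext: "\<exists>M'. M' \<subseteq> L \<and> M' \<noteq> {} \<and> shape (induced M' (Node ts)) = caterpillar (Suc (Suc n))"
      if "t \<in> U" "M \<subseteq> leaves t \<inter> L" "M \<noteq> {}" "shape (induced M t) = caterpillar (Suc n)" for t M n
    proof -
      obtain s' where s': "s' \<in> U" "s' \<noteq> t" using few(1,2) t0 by metis
      then obtain x where x: "x \<in> leaves s'" "x \<in> L" by (auto simp: U_def)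
      have "shape (induced (insert x M) (Node ts)) = caterpillar (Suc (Suc n))"
        using that s' x U(2) by (intro caterpillar_extend[OF T, of t M n s']) auto
      then show ?thesis using x that by (intro exI[of _ "insert x M"]) auto
    qed
    show ?thesis
    proof (cases h)
      \<comment> \<open>A single leaf is \<open>caterpillar (Suc 0)\<close>, and one extension gives
        the required two-leaf caterpillar.\<close>
      case 0
      obtain x where x: "x \<in> leaves t0" "x \<in> L" using t0 by (auto simp: U_def)
      have "induced {x} t0 = Leaf x"
        using x t0 U(2) child by (intro induced_singleton) auto
      then show ?thesis using ext[OF t0, of "{x}" 0] x 0 by auto
    next
      case (Suc j)
      \<comment> \<open>Pigeonhole: at most \<open>d\<close> children share more than
        \<open>d * d ^ j\<close> leaves of \<open>L\<close>.\<close>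
      have "\<exists>t\<in>U. d ^ j < card (leaves t \<inter> L)"
      proof (rule ccontr)
        assume "\<not> ?thesis"
        then have le: "card (leaves t \<inter> L) \<le> d ^ j" if "t \<in> U" for t
          using that by (simp add: not_less)
        have "card L = card (\<Union>t\<in>U. leaves t \<inter> L)"
          by (rule arg_cong[OF LU])
        also have "\<dots> \<le> (\<Sum>t\<in>U. card (leaves t \<inter> L))"
          by (rule card_UN_le[OF U(1)])
        also have "\<dots> \<le> card U * d ^ j"
          using sum_bounded_above[OF le] by simp
        also have "\<dots> \<le> d * d ^ j"
          using few(3) by (rule mult_le_mono1)
        finally show False using Node.prems(4) Suc by simp
      qed
      then obtain t where t: "t \<in> U" "d ^ j < card (leaves t \<inter> L)" by blast
      then have "t \<in># ts" using U(2) by blast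
      from Node.IH[OF this child[OF this] Int_lower1 t(2)]
      obtain M where M: "M \<subseteq> leaves t \<inter> L" "M \<noteq> {}"
        "shape (induced M t) = star (Suc d) \<or> shape (induced M t) = caterpillar (Suc (Suc j))"
        by blast
      show ?thesis
        using M(3)
      proof
        assume "shape (induced M t) = star (Suc d)"
        then show ?thesis using M(1,2) lift[OF \<open>t \<in># ts\<close>, of M] by (intro exI[of _ M]) simp
      next
        assume "shape (induced M t) = caterpillar (Suc (Suc j))"
        from ext[OF t(1) M(1,2) this] show ?thesis using Suc by blast
      qed
    qed
  qed
qed

section \<open>Densities and the limit inferior\<close>

lemma density_star_caterpillar:
  assumes k: "2 \<le> k" and T: "topological T" "distinct_leaves T"
    and N: "N = 1 + (k - 1) ^ (k - 2)" "k \<le> N" "N \<le> num_leaves T"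
  shows "1 / real (N choose k) \<le> density (star k) T + density (caterpillar k) T"
proof -
  define A where "A S = {L. L \<subseteq> leaves T \<and> L \<noteq> {} \<and> shape (induced L T) = S}" for S
  \<comment> \<open>\<open>copies\<close> compares with the shape of its first argument; trees over
    \<open>unit\<close> are their own shapes.\<close>
  have sk: "shape (star k) = star k" and ck: "shape (caterpillar k) = caterpillar k"
    by (simp_all add: tree.map_ident_strong)
  let ?G = "A (star k) \<union> A (caterpillar k)"
  have X: "card (leaves T) = num_leaves T" using T(2) by (rule card_leaves)
  have cover: "num_leaves T choose k \<le> card ?G * (N choose k)"
    unfolding X[symmetric]
  proof (rule binomial_le_card_covering)
    fix M assume M: "M \<in> ?G"
    then have "num_leaves (shape (induced M T)) = k" "M \<subseteq> leaves T" "M \<noteq> {}"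
      using k by (auto simp: A_def num_leaves_star num_leaves_caterpillar)
    then show "M \<subseteq> leaves T \<and> card M = k"
      using num_leaves_induced[OF T(2)] by (metis num_leaves_map)
  next
    fix L assume L: "L \<subseteq> leaves T" "card L = N"
    \<comment> \<open>Here \<open>d = k - 1\<close> and \<open>h = k - 2\<close>, so
      \<open>N\<close> exceeds \<open>d ^ h\<close> by exactly one.\<close>
    have "\<exists>M. M \<subseteq> L \<and> M \<noteq> {} \<and> (shape (induced M T) = star (Suc (k - 1)) \<or>
        shape (induced M T) = caterpillar (Suc (Suc (k - 2))))"
      by (rule star_or_caterpillar) (use k T L N in auto)
    moreover have "Suc (k - 1) = k" "Suc (Suc (k - 2)) = k" using k by auto
    ultimately obtain M where "M \<subseteq> L" "M \<noteq> {}"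
      "shape (induced M T) = star k \<or> shape (induced M T) = caterpillar k" by metis
    then show "\<exists>M\<in>?G. M \<subseteq> L"
      using L(1) by (intro bexI[of _ M]) (auto simp: A_def)
  qed (use N X finite_leaves in auto)
  \<comment> \<open>Only an inequality: for \<open>k = 2\<close> the star and the caterpillar
    coincide and the union counts each set once.\<close>
  have "card ?G \<le> copies (star k) T + copies (caterpillar k) T"
    by (rule order_trans[OF card_Un_le]) (simp add: copies_def A_def sk ck)
  from order_trans[OF cover mult_le_mono1[OF this]] have "real (num_leaves T choose k) \<le>
      real ((copies (star k) T + copies (caterpillar k) T) * (N choose k))"
    by (simp only: of_nat_le_iff)
  moreover have "0 < N choose k" "0 < num_leaves T choose k"
    using N by simp_all
  ultimately show ?thesis
    using k by (simp add: density_def num_leaves_star num_leaves_caterpillar field_simps)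
qed

theorem proposition6:
  fixes k :: nat
  assumes "2 \<le> k"
  shows "liminf (\<lambda>n. ereal (Min ((\<lambda>T. density (star k) T + density (caterpillar k) T)
             ` topological_trees n)))
           \<ge> ereal (1 / real ((1 + (k - 1) ^ (k - 2)) choose k))
         \<and> 1 / real ((1 + (k - 1) ^ (k - 2)) choose k)
           \<ge> fact k / real (1 + (k - 1) ^ (k - 2)) ^ k"
proof
  define N where "N = 1 + (k - 1) ^ (k - 2)"
  \<comment> \<open>This yields \<open>k \<le> N\<close>, so that \<open>N choose k\<close> is
    positive. For \<open>k = 2\<close> the exponent is 0 and both sides equal 1.\<close>
  have "k - 1 \<le> (k - 1) ^ (k - 2)"
  proof (cases "k = 2")
    case False
    then show ?thesis using assms by (intro self_le_power) auto
  qed simp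
  then have kN: "k \<le> N" by (simp add: N_def)
  have "1 / real (N choose k)
      \<le> Min ((\<lambda>T. density (star k) T + density (caterpillar k) T) ` topological_trees n)"
    if "N \<le> n" for n
  proof (rule Min.boundedI[OF finite_density_values])
    show "(\<lambda>T. density (star k) T + density (caterpillar k) T) ` topological_trees n \<noteq> {}"
      using topological_trees_nonempty[of n] that assms kN by simp
  qed (use density_star_caterpillar[OF assms _ _ N_def kN] that in \<open>auto simp: topological_trees_def\<close>)
  then show "liminf (\<lambda>n. ereal (Min ((\<lambda>T. density (star k) T + density (caterpillar k) T)
             ` topological_trees n))) \<ge> ereal (1 / real ((1 + (k - 1) ^ (k - 2)) choose k))"
    unfolding N_def[symmetric]
    by (intro Liminf_bounded eventually_sequentiallyI[of N]) simp
  \<comment> \<open>The left side is the falling factorial of \<open>N\<close> with \<open>k\<close>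
    factors, each at most \<open>N\<close>.\<close>
  have "real ((N choose k) * fact k) \<le> real (N ^ k)"
    by (simp only: of_nat_le_iff binomial_fact_pow)
  then have "real (N choose k) * fact k \<le> real N ^ k"
    by simp
  moreover have "0 < N choose k" "0 < N" using kN by (simp_all add: N_def)
  ultimately show "1 / real ((1 + (k - 1) ^ (k - 2)) choose k)
           \<ge> fact k / real (1 + (k - 1) ^ (k - 2)) ^ k"
    unfolding N_def[symmetric] by (simp add: field_simps)
qed

end
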